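(* Let $n=p_1^{a_1}p_2^{a_2}\cdots p_k^{a_k}$, where the $p_i$ are distinct primes and each $a_i$ is a positive integer, and let $Q$ be the poset of join-irreducible elements of the divisibility lattice $L_n$ (i.e., the prime powers $p_i^{b}$, $1\le b\le a_i$, ordered by divisibility; $Q$ is a disjoint sum of chains). Partition $Q$ as $Q_1+Q_2+\cdots+Q_j$, where $Q_i$ consists of $t_i$ chains, each consisting of $r_i$ points, and $r_1,\dots,r_j$ are distinct. For $1\le i\le j$, let $m_i$ be the smallest nonnegative integer such that $t_i\le \sum_{\ell=0}^{\min\{r_i,m_i\}}\binom{r_i}{\ell}(m_i)_\ell$, and let $m=\max\{m_i:1\le i\le j\}$. Then $\chi_D(L_n)\le m+|Q|+1$.
   Context: $L_n$ is the poset of positive divisors of $n$ ordered by divisibility. $(m)_\ell=m(m-1)\cdots(m-\ell+1)$ with $(m)_0=1$. For a finite poset $P$, a coloring is proper if comparable points get different colors and distinguishing if the only color-preserving automorphism is the identity; $\chi_D(P)$ is the least number of colors in a proper distinguishing coloring of $P$. *)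

theory Defs
  imports Complex_Main "HOL-Computational_Algebra.Primes"
begin

text \<open>A poset is given by its set \<open>A\<close> of points together with an order relation \<open>le\<close>, of which only
  the restriction to \<open>A\<close> matters.\<close>

definition order_automorphism :: "'a set \<Rightarrow> ('a \<Rightarrow> 'a \<Rightarrow> bool) \<Rightarrow> ('a \<Rightarrow> 'a) \<Rightarrow> bool" where
  "order_automorphism A le f \<longleftrightarrow>
     bij_betw f A A \<and> (\<forall>x\<in>A. \<forall>y\<in>A. le x y \<longleftrightarrow> le (f x) (f y))"

definition proper_coloring :: "'a set \<Rightarrow> ('a \<Rightarrow> 'a \<Rightarrow> bool) \<Rightarrow> ('a \<Rightarrow> 'c) \<Rightarrow> bool" where
  "proper_coloring A le c \<longleftrightarrow>
     (\<forall>x\<in>A. \<forall>y\<in>A. x \<noteq> y \<and> (le x y \<or> le y x) \<longrightarrow> c x \<noteq> c y)"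

definition distinguishing_coloring :: "'a set \<Rightarrow> ('a \<Rightarrow> 'a \<Rightarrow> bool) \<Rightarrow> ('a \<Rightarrow> 'c) \<Rightarrow> bool" where
  "distinguishing_coloring A le c \<longleftrightarrow>
     (\<forall>f. order_automorphism A le f \<and> (\<forall>x\<in>A. c (f x) = c x) \<longrightarrow> (\<forall>x\<in>A. f x = x))"

text \<open>The colors are \<open>0, \<dots>, N - 1\<close>. The minimum exists for every finite \<open>A\<close>, since an injective
  coloring is proper and distinguishing.\<close>

definition chi_D :: "'a set \<Rightarrow> ('a \<Rightarrow> 'a \<Rightarrow> bool) \<Rightarrow> nat" where
  "chi_D A le = (LEAST N. \<exists>c :: 'a \<Rightarrow> nat. c ` A \<subseteq> {..<N} \<and>
     proper_coloring A le c \<and> distinguishing_coloring A le c)"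

definition divisor_lattice :: "nat \<Rightarrow> nat set" where
  "divisor_lattice n = {d. d dvd n}"

definition is_join :: "'a set \<Rightarrow> ('a \<Rightarrow> 'a \<Rightarrow> bool) \<Rightarrow> 'a \<Rightarrow> 'a \<Rightarrow> 'a \<Rightarrow> bool" where
  "is_join A le x y z \<longleftrightarrow>
     z \<in> A \<and> le x z \<and> le y z \<and> (\<forall>w\<in>A. le x w \<and> le y w \<longrightarrow> le z w)"

text \<open>The second conjunct excludes the bottom element.\<close>

definition join_irreducibles :: "'a set \<Rightarrow> ('a \<Rightarrow> 'a \<Rightarrow> bool) \<Rightarrow> 'a set" where
  "join_irreducibles A le = {z \<in> A. \<not> (\<forall>w\<in>A. le z w) \<and>
     (\<forall>x\<in>A. \<forall>y\<in>A. is_join A le x y z \<longrightarrow> z = x \<or> z = y)}"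

text \<open>\<open>A\<close> is the disjoint sum, as a poset, of its subposets \<open>P i\<close> for \<open>i \<in> I\<close>.\<close>

definition is_poset_sum :: "('a \<Rightarrow> 'a \<Rightarrow> bool) \<Rightarrow> 'i set \<Rightarrow> ('i \<Rightarrow> 'a set) \<Rightarrow> 'a set \<Rightarrow> bool" where
  "is_poset_sum le I P A \<longleftrightarrow> A = (\<Union>i\<in>I. P i) \<and>
     (\<forall>i\<in>I. \<forall>l\<in>I. i \<noteq> l \<longrightarrow> P i \<inter> P l = {} \<and> (\<forall>x\<in>P i. \<forall>y\<in>P l. \<not> le x y))"

definition is_chain :: "('a \<Rightarrow> 'a \<Rightarrow> bool) \<Rightarrow> 'a set \<Rightarrow> bool" where
  "is_chain le C \<longleftrightarrow> (\<forall>x\<in>C. \<forall>y\<in>C. le x y \<or> le y x)"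

text \<open>\<open>A\<close> is a disjoint sum of \<open>t\<close> chains with \<open>r\<close> points each.\<close>

definition consists_of_chains :: "('a \<Rightarrow> 'a \<Rightarrow> bool) \<Rightarrow> 'a set \<Rightarrow> nat \<Rightarrow> nat \<Rightarrow> bool" where
  "consists_of_chains le A t r \<longleftrightarrow>
     (\<exists>C :: nat \<Rightarrow> 'a set. is_poset_sum le {1..t} C A \<and>
        (\<forall>s\<in>{1..t}. is_chain le (C s) \<and> finite (C s) \<and> card (C s) = r))"

text \<open>Truncated subtraction is harmless: for \<open>l > m\<close> the factor at \<open>i = m\<close> is 0.\<close>

definition falling_factorial :: "nat \<Rightarrow> nat \<Rightarrow> nat" where
  "falling_factorial m l = (\<Prod>i<l. m - i)"

end

(* Only two features of the divisor lattice matter: it is a finite poset, and its poset Q of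
   join-irreducibles is a sum of chains. Let the rank of x be the number of join-irreducibles below x;
   it is strictly increasing, so coloring by rank is proper and uses |Q| + 1 colors. Now recolor some
   points of Q with M extra colors, each chain according to a partial injection from its positions to
   the extra colors. The sum in the definition of m_i counts the partial injections of a chain with
   r_i points, so chains of equal size can be given different ones. An automorphism preserves Q and the
   rank, hence maps chains to chains of the same size and keeps positions; if it preserves colors, it
   preserves the partial injections, so it fixes every chain, and every point of Q. As each element is
   a join of join-irreducibles, it is the identity. *)

theory Submission
  imports Defs "HOL-Library.FuncSet"
begin

section \<open>Invariance of joins and join-irreducibles under automorphisms\<close>

lemma order_automorphism_is_join:
  assumes f: "order_automorphism A le f" and "x \<in> A" "y \<in> A" "z \<in> A"
  shows "is_join A le (f x) (f y) (f z) \<longleftrightarrow> is_join A le x y z"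
proof -
  have fA: "f ` A = A" and le: "\<And>u v. u \<in> A \<Longrightarrow> v \<in> A \<Longrightarrow> le (f u) (f v) \<longleftrightarrow> le u v"
    using f by (auto simp: order_automorphism_def bij_betw_def)
  \<comment> \<open>Since \<open>f\<close> maps \<open>A\<close> onto \<open>A\<close>, a bound
    variable ranging over \<open>A\<close> may be replaced by \<open>f w\<close>.\<close>
  have all: "(\<forall>w\<in>A. P w) \<longleftrightarrow> (\<forall>w\<in>A. P (f w))" for P
    using fA by (metis image_iff)
  have "f z \<in> A"
    using fA assms(4) by blast
  moreover have "(\<forall>w\<in>A. le (f x) w \<and> le (f y) w \<longrightarrow> le (f z) w) \<longleftrightarrow>
      (\<forall>w\<in>A. le x w \<and> le y w \<longrightarrow> le z w)"
    unfolding all[of "\<lambda>w. le (f x) w \<and> le (f y) w \<longrightarrow> le (f z) w"] by (simp add: le assms(2-4))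
  ultimately show ?thesis
    using assms(2-4) by (simp add: is_join_def le)
qed

lemma order_automorphism_join_irreducibles:
  assumes f: "order_automorphism A le f" and z: "z \<in> A"
  shows "f z \<in> join_irreducibles A le \<longleftrightarrow> z \<in> join_irreducibles A le"
proof -
  have fA: "f ` A = A" and inj: "inj_on f A"
    and le: "\<And>u v. u \<in> A \<Longrightarrow> v \<in> A \<Longrightarrow> le (f u) (f v) \<longleftrightarrow> le u v"
    using f by (auto simp: order_automorphism_def bij_betw_def)
  have all: "(\<forall>w\<in>A. P w) \<longleftrightarrow> (\<forall>w\<in>A. P (f w))" for P
    using fA by (metis image_iff)
  \<comment> \<open>Stated over the image of \<open>A\<close> under \<open>f\<close>, the two
    quantifiers can be pulled back along \<open>f\<close>; only afterwards is the image rewritten to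
    \<open>A\<close>.\<close>
  have "(\<forall>x\<in>f ` A. \<forall>y\<in>f ` A. R x y) \<longleftrightarrow> (\<forall>x\<in>A. \<forall>y\<in>A. R (f x) (f y))" for R
    by simp
  then have all2: "(\<forall>x\<in>A. \<forall>y\<in>A. R x y) \<longleftrightarrow> (\<forall>x\<in>A. \<forall>y\<in>A. R (f x) (f y))" for R
    unfolding fA .
  have fz: "f z \<in> A"
    using fA z by blast
  have eq: "\<And>u v. u \<in> A \<Longrightarrow> v \<in> A \<Longrightarrow> f u = f v \<longleftrightarrow> u = v"
    using inj by (auto simp: inj_on_eq_iff)
  have bottom: "(\<forall>w\<in>A. le (f z) w) \<longleftrightarrow> (\<forall>w\<in>A. le z w)"
    unfolding all[of "le (f z)"] by (simp add: le z)
  have "(\<forall>x\<in>A. \<forall>y\<in>A. is_join A le x y (f z) \<longrightarrow> f z = x \<or> f z = y) \<longleftrightarrow>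
      (\<forall>x\<in>A. \<forall>y\<in>A. is_join A le (f x) (f y) (f z) \<longrightarrow> f z = f x \<or> f z = f y)"
    by (rule all2)
  also have "\<dots> \<longleftrightarrow> (\<forall>x\<in>A. \<forall>y\<in>A. is_join A le x y z \<longrightarrow> z = x \<or> z = y)"
    using z by (simp add: order_automorphism_is_join[OF f] eq)
  finally have irreducible: "(\<forall>x\<in>A. \<forall>y\<in>A. is_join A le x y (f z) \<longrightarrow> f z = x \<or> f z = y) \<longleftrightarrow>
      (\<forall>x\<in>A. \<forall>y\<in>A. is_join A le x y z \<longrightarrow> z = x \<or> z = y)" .
  show ?thesis
    unfolding join_irreducibles_def mem_Collect_eq bottom irreducible by (simp only: z fz)
qed

section \<open>Rank in a finite poset\<close>

locale finite_poset =
  fixes A :: "'a set" and le :: "'a \<Rightarrow> 'a \<Rightarrow> bool"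
  assumes finite: "finite A"
    and refl: "x \<in> A \<Longrightarrow> le x x"
    and trans: "\<lbrakk>x \<in> A; y \<in> A; z \<in> A; le x y; le y z\<rbrakk> \<Longrightarrow> le x z"
    and antisym: "\<lbrakk>x \<in> A; y \<in> A; le x y; le y x\<rbrakk> \<Longrightarrow> x = y"
begin

abbreviation JI :: "'a set" where
  "JI \<equiv> join_irreducibles A le"

text \<open>In the divisor lattice this is the number of prime factors counted with
  multiplicity.\<close>

definition rank :: "'a \<Rightarrow> nat" where
  "rank x = card {y \<in> JI. le y x}"

lemma JI_subset: "JI \<subseteq> A"
  by (auto simp: join_irreducibles_def)

lemma finite_JI: "finite JI"
  using finite JI_subset finite_subset by blast

lemma rank_le: "rank x \<le> card JI"
  unfolding rank_def by (rule card_mono[OF finite_JI]) auto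

text \<open>Every element is a join of join-irreducibles: a join-reducible \<open>z\<close> is the join of two strictly
  smaller elements.\<close>

lemma le_if_JI_le:
  assumes "z \<in> A" "e \<in> A" "\<And>y. y \<in> JI \<Longrightarrow> le y z \<Longrightarrow> le y e"
  shows "le z e"
  using assms(1,3)
proof (induction "card {w \<in> A. le w z}" arbitrary: z rule: less_induct)
  case less
  consider "\<forall>w\<in>A. le z w" | "z \<in> JI"
    | x y where "x \<in> A" "y \<in> A" "is_join A le x y z" "z \<noteq> x" "z \<noteq> y"
    using less.prems(1) by (auto simp: join_irreducibles_def)
  then show ?case
  proof cases
    case 1
    then show ?thesis using assms(2) by blast
  next
    case 2
    then show ?thesis using less.prems refl by blast
  next
    case 3
    \<comment> \<open>The hypothesis on join-irreducibles passes from \<open>z\<close> down to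
      \<open>u\<close> by transitivity, and the down-set of \<open>u\<close> is smaller because it
      misses \<open>z\<close>.\<close>
    have below: "le u e" if u: "u \<in> A" "le u z" "u \<noteq> z" for u
    proof (rule less.hyps)
      have "{w \<in> A. le w u} \<subset> {w \<in> A. le w z}"
      proof
        show "{w \<in> A. le w u} \<subseteq> {w \<in> A. le w z}"
          using u less.prems(1) trans by blast
        show "{w \<in> A. le w u} \<noteq> {w \<in> A. le w z}"
          using u less.prems(1) refl antisym by blast
      qed
      then show "card {w \<in> A. le w u} < card {w \<in> A. le w z}"
        using finite by (intro psubset_card_mono) auto
      show "u \<in> A" by fact
      show "le y e" if "y \<in> JI" "le y u" for y
        using that less.prems u JI_subset trans[of y u z] by blast
    qed
    then have "le x e" "le y e"
      using 3 by (auto simp: is_join_def)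
    then show ?thesis
      using 3 assms(2) by (auto simp: is_join_def)
  qed
qed

text \<open>If \<open>x\<close> and \<open>y\<close> had the same join-irreducibles below them,
  \<open>le_if_JI_le\<close> would give \<open>le y x\<close>, against antisymmetry.\<close>

lemma rank_strict_mono:
  assumes "x \<in> A" "y \<in> A" "le x y" "x \<noteq> y"
  shows "rank x < rank y"
proof -
  have "{u \<in> JI. le u x} \<subseteq> {u \<in> JI. le u y}"
    using assms trans JI_subset by blast
  moreover have "{u \<in> JI. le u x} \<noteq> {u \<in> JI. le u y}"
    using assms le_if_JI_le[of y x] antisym by blast
  ultimately show ?thesis
    unfolding rank_def using finite_JI by (intro psubset_card_mono) auto
qed

text \<open>\<open>f\<close> maps the join-irreducibles below \<open>x\<close> bijectively onto
  those below \<open>f x\<close>.\<close>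

lemma rank_automorphism:
  assumes f: "order_automorphism A le f" and x: "x \<in> A"
  shows "rank (f x) = rank x"
proof -
  have fA: "f ` A = A" and inj: "inj_on f A"
    and le: "\<And>u v. u \<in> A \<Longrightarrow> v \<in> A \<Longrightarrow> le (f u) (f v) \<longleftrightarrow> le u v"
    using f by (auto simp: order_automorphism_def bij_betw_def)
  have "{y \<in> JI. le y (f x)} = f ` {y \<in> JI. le y x}"
  proof (intro equalityI subsetI)
    fix y assume y: "y \<in> {y \<in> JI. le y (f x)}"
    then obtain u where "u \<in> A" "y = f u"
      using fA JI_subset by blast
    then show "y \<in> f ` {y \<in> JI. le y x}"
      using y order_automorphism_join_irreducibles[OF f] le x by auto
  next
    fix y assume "y \<in> f ` {y \<in> JI. le y x}"
    then show "y \<in> {y \<in> JI. le y (f x)}"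
      using order_automorphism_join_irreducibles[OF f] le x JI_subset by auto
  qed
  moreover have "inj_on f {y \<in> JI. le y x}"
    using inj JI_subset by (auto intro: inj_on_subset)
  ultimately show ?thesis
    unfolding rank_def by (simp add: card_image)
qed

end

section \<open>Posets whose join-irreducibles form a sum of chains\<close>

locale JI_sum_of_chains = finite_poset A le
  for A :: "'a set" and le :: "'a \<Rightarrow> 'a \<Rightarrow> bool" +
  fixes I :: "'i set" and C :: "'i \<Rightarrow> 'a set"
  assumes sum: "is_poset_sum le I C (join_irreducibles A le)"
    and chain: "s \<in> I \<Longrightarrow> is_chain le (C s)"
begin

lemma chain_subset: "s \<in> I \<Longrightarrow> C s \<subseteq> JI"
  using sum by (auto simp: is_poset_sum_def)

lemma same_chain:
  assumes "s \<in> I" "s' \<in> I" "x \<in> C s" "y \<in> C s'" "le x y \<or> le y x"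
  shows "s = s'"
proof (rule ccontr)
  assume "s \<noteq> s'"
  \<comment> \<open>For one ordered pair of indices a sum excludes \<open>le\<close> in one
    direction only, so both orders of the indices are used.\<close>
  then have "\<forall>x\<in>C s. \<forall>y\<in>C s'. \<not> le x y" "\<forall>y\<in>C s'. \<forall>x\<in>C s. \<not> le y x"
    using sum assms(1,2) by (simp_all add: is_poset_sum_def)
  then show False
    using assms(3-5) by blast
qed

lemma finite_chain: "s \<in> I \<Longrightarrow> finite (C s)"
  using chain_subset finite_JI finite_subset by metis

lemma rank_inj_on_chain:
  assumes s: "s \<in> I"
  shows "inj_on rank (C s)"
proof (rule inj_onI, rule ccontr)
  fix x y assume *: "x \<in> C s" "y \<in> C s" "rank x = rank y" "x \<noteq> y"
  then have "x \<in> A" "y \<in> A" "le x y \<or> le y x"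
    using s chain_subset JI_subset chain[OF s] by (auto simp: is_chain_def)
  then show False
    using * rank_strict_mono[of x y] rank_strict_mono[of y x] by auto
qed

text \<open>The join-irreducibles below a point of a chain are comparable to it, hence in the same
  chain. So the rank, although defined in all of \<open>A\<close>, is the position in the chain
  counted from 1; injectivity and a count show that every position occurs.\<close>

lemma rank_image_chain:
  assumes s: "s \<in> I"
  shows "rank ` C s = {1..card (C s)}"
proof (rule card_subset_eq)
  show "rank ` C s \<subseteq> {1..card (C s)}"
  proof
    fix b assume "b \<in> rank ` C s"
    then obtain x where x: "x \<in> C s" "b = rank x" by blast
    have "{y \<in> JI. le y x} \<subseteq> C s"
    proof
      fix y assume y: "y \<in> {y \<in> JI. le y x}"
      then obtain s' where "s' \<in> I" "y \<in> C s'"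
        using sum by (auto simp: is_poset_sum_def)
      then show "y \<in> C s"
        using same_chain[OF s, of s' x y] x y by auto
    qed
    then have "rank x \<le> card (C s)"
      unfolding rank_def by (rule card_mono[OF finite_chain[OF s]])
    moreover have "x \<in> {y \<in> JI. le y x}"
      using x s chain_subset JI_subset refl by blast
    then have "rank x > 0"
      unfolding rank_def using finite_JI by (auto simp: card_gt_0_iff)
    ultimately show "b \<in> {1..card (C s)}"
      using x by simp
  qed
  show "card (rank ` C s) = card {1..card (C s)}"
    using rank_inj_on_chain[OF s] by (simp add: card_image)
qed simp

text \<open>The description is determined only for join-irreducible \<open>x\<close>;
  \<open>label_coloring\<close> therefore tests membership in \<open>JI\<close> first.\<close>

definition chain_of :: "'a \<Rightarrow> 'i" where
  "chain_of x = (THE s. s \<in> I \<and> x \<in> C s)"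

lemma chain_of_eq:
  assumes "s \<in> I" "x \<in> C s"
  shows "chain_of x = s"
  unfolding chain_of_def
proof (rule the_equality)
  have "le x x"
    using assms chain_subset JI_subset refl by blast
  then show "s' = s" if "s' \<in> I \<and> x \<in> C s'" for s'
    using that assms same_chain[of s' s x x] by blast
qed (use assms in blast)

lemma chain_of_JI:
  assumes "x \<in> JI"
  shows "chain_of x \<in> I" "x \<in> C (chain_of x)"
proof -
  obtain s where "s \<in> I" "x \<in> C s"
    using assms sum by (auto simp: is_poset_sum_def)
  then show "chain_of x \<in> I" "x \<in> C (chain_of x)"
    using chain_of_eq by auto
qed

text \<open>Comparability is preserved and reflected by \<open>f\<close>, and comparable
  join-irreducibles share a chain. Hence one point \<open>x\<close> carries its whole chain along;
  surjectivity of \<open>f\<close> gives the reverse inclusion.\<close>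

lemma automorphism_image_chain:
  assumes f: "order_automorphism A le f" and s: "s \<in> I" "s' \<in> I" and x: "x \<in> C s" "f x \<in> C s'"
  shows "f ` C s = C s'"
proof (intro equalityI subsetI)
  have fA: "f ` A = A"
    and le: "\<And>u v. u \<in> A \<Longrightarrow> v \<in> A \<Longrightarrow> le (f u) (f v) \<longleftrightarrow> le u v"
    using f by (auto simp: order_automorphism_def bij_betw_def)
  have CA: "C s \<subseteq> A" "C s' \<subseteq> A"
    using s chain_subset JI_subset by blast+
  {
    fix y assume "y \<in> f ` C s"
    then obtain u where u: "u \<in> C s" "y = f u" by blast
    have "u \<in> A" "x \<in> A" using u x CA by auto
    moreover have "y \<in> JI"
      using u s chain_subset order_automorphism_join_irreducibles[OF f \<open>u \<in> A\<close>] by auto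
    then obtain s'' where s'': "s'' \<in> I" "y \<in> C s''"
      using chain_of_JI by blast
    moreover have "le u x \<or> le x u"
      using chain[OF s(1)] u x by (auto simp: is_chain_def)
    ultimately have "le y (f x) \<or> le (f x) y"
      using u le by auto
    then show "y \<in> C s'"
      using same_chain[OF s''(1) s(2) s''(2) x(2)] s'' by auto
  next
    fix y assume y: "y \<in> C s'"
    then obtain u where u: "u \<in> A" "y = f u"
      using CA fA by blast
    have "x \<in> A" using x CA by auto
    have "u \<in> JI"
      using u y s chain_subset order_automorphism_join_irreducibles[OF f \<open>u \<in> A\<close>] by auto
    then obtain s'' where s'': "s'' \<in> I" "u \<in> C s''"
      using chain_of_JI by blast
    have "le (f x) y \<or> le y (f x)"
      using chain[OF s(2)] y x by (auto simp: is_chain_def)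
    then have "le u x \<or> le x u"
      using u le \<open>x \<in> A\<close> by auto
    then show "y \<in> f ` C s"
      using same_chain[OF s''(1) s(1) s''(2) x(1)] s'' u by auto
  }
qed

text \<open>The label of chain \<open>s\<close> is a partial map: \<open>S s\<close> holds the
  positions to be recolored and \<open>g s\<close> their extra colors. Ranks go up to
  \<open>card JI\<close>, so the offset \<open>card JI + 1\<close> keeps extra colors apart from
  them.\<close>

definition label_coloring :: "('i \<Rightarrow> nat set) \<Rightarrow> ('i \<Rightarrow> nat \<Rightarrow> nat) \<Rightarrow> 'a \<Rightarrow> nat" where
  "label_coloring S g x =
     (if x \<in> JI \<and> rank x \<in> S (chain_of x) then card JI + 1 + g (chain_of x) (rank x) else rank x)"

text \<open>Two rank colors differ by strict monotonicity, and a rank color never equals an extra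
  one. Two comparable recolored points lie in one chain at different ranks, where \<open>g s\<close>
  is injective.\<close>

lemma label_coloring_proper:
  assumes inj: "\<And>s. s \<in> I \<Longrightarrow> inj_on (g s) (S s)"
  shows "proper_coloring A le (label_coloring S g)"
proof -
  have neq: "label_coloring S g x \<noteq> label_coloring S g y"
    if xy: "x \<in> A" "y \<in> A" "x \<noteq> y" "le x y" for x y
  proof -
    have rk: "rank x < rank y"
      using xy by (simp add: rank_strict_mono)
    have False if "label_coloring S g x = label_coloring S g y"
      "x \<in> JI" "rank x \<in> S (chain_of x)" "y \<in> JI" "rank y \<in> S (chain_of y)"
    proof -
      have "chain_of x = chain_of y"
        using same_chain[of "chain_of x" "chain_of y" x y] chain_of_JI that xy by simp
      then show False
        using that rk inj[OF chain_of_JI(1)[OF \<open>x \<in> JI\<close>]]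
        by (simp add: label_coloring_def inj_on_eq_iff)
    qed
    then show ?thesis
      using rk rank_le[of x] rank_le[of y] by (fastforce simp: label_coloring_def split: if_splits)
  qed
  then show ?thesis
    unfolding proper_coloring_def by metis
qed

lemma label_coloring_distinguishing:
  assumes label: "\<And>s. s \<in> I \<Longrightarrow> S s \<subseteq> {1..card (C s)} \<and> g s \<in> extensional (S s)"
    and labels_differ: "\<And>s s'. \<lbrakk>s \<in> I; s' \<in> I; card (C s) = card (C s'); S s = S s'; g s = g s'\<rbrakk> \<Longrightarrow> s = s'"
  shows "distinguishing_coloring A le (label_coloring S g)"
  unfolding distinguishing_coloring_def
proof (intro allI impI, elim conjE)
  let ?c = "label_coloring S g"
  fix f assume f: "order_automorphism A le f" and col: "\<forall>x\<in>A. ?c (f x) = ?c x"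
  have fA: "f ` A = A" and inj: "inj_on f A"
    and le: "\<And>u v. u \<in> A \<Longrightarrow> v \<in> A \<Longrightarrow> le (f u) (f v) \<longleftrightarrow> le u v"
    using f by (auto simp: order_automorphism_def bij_betw_def)
  have fix_JI: "f x = x" if x: "x \<in> JI" for x
  proof -
    obtain s where s: "s \<in> I" "x \<in> C s"
      using x chain_of_JI by blast
    have xA: "x \<in> A" using x JI_subset by blast
    have "f x \<in> JI"
      using x xA order_automorphism_join_irreducibles[OF f] by simp
    then obtain s' where s': "s' \<in> I" "f x \<in> C s'"
      using chain_of_JI by blast
    have img: "f ` C s = C s'"
      using automorphism_image_chain[OF f] s s' by blast
    have "inj_on f (C s)"
      using inj s chain_subset JI_subset by (meson inj_on_subset subset_trans)
    then have card: "card (C s) = card (C s')"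
      using img card_image by fastforce
    \<comment> \<open>The point of \<open>C s\<close> at position \<open>b\<close> goes to the point
      of \<open>C s'\<close> at position \<open>b\<close>. Their common color shows whether
      \<open>b\<close> is recolored and, if so, by which extra color.\<close>
    have same: "(b \<in> S s \<longleftrightarrow> b \<in> S s') \<and> (b \<in> S s \<longrightarrow> g s b = g s' b)" if b: "b \<in> {1..card (C s)}" for b
    proof -
      obtain y where y: "y \<in> C s" "rank y = b"
        using b rank_image_chain[OF s(1)] by (metis imageE)
      have yJ: "y \<in> JI" "y \<in> A" using y s chain_subset JI_subset by blast+
      have fy: "f y \<in> C s'" "f y \<in> JI"
        using y img s' chain_subset by blast+
      have "?c (f y) = ?c y"
        using col yJ by blast
      moreover have "chain_of y = s" "chain_of (f y) = s'" "rank (f y) = b"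
        using y s s' fy chain_of_eq rank_automorphism[OF f] yJ by auto
      ultimately show ?thesis
        using y yJ fy rank_le[of y] by (auto simp: label_coloring_def split: if_splits)
    qed
    have "S s = S s'"
      using same label[OF s(1)] label[OF s'(1)] card by auto
    moreover have "g s = g s'"
    \<comment> \<open>Agreement on \<open>S s\<close> gives equality of functions because both are
      undefined in the same way outside it.\<close>
    proof (rule extensionalityI[of _ "S s"])
      show "g s \<in> extensional (S s)" "g s' \<in> extensional (S s)"
        using label[OF s(1)] label[OF s'(1)] \<open>S s = S s'\<close> by simp_all
      show "g s b = g s' b" if "b \<in> S s" for b
        using that same label[OF s(1)] by blast
    qed
    ultimately have "s = s'"
      using labels_differ s s' card by blast
    \<comment> \<open>\<open>x\<close> and \<open>f x\<close> now lie in one chain and have equal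
      rank.\<close>
    then show "f x = x"
      using s s' rank_inj_on_chain[OF s(1)] rank_automorphism[OF f xA] by (auto simp: inj_on_def)
  qed
  show "\<forall>x\<in>A. f x = x"
  proof
    fix x assume x: "x \<in> A"
    have fx: "f x \<in> A" using x fA by blast
    \<comment> \<open>As \<open>y\<close> is fixed, \<open>x\<close> and \<open>f x\<close> have the
      same join-irreducibles below them, and these determine an element.\<close>
    have "le y (f x) \<longleftrightarrow> le y x" if y: "y \<in> JI" for y
      using le[of y x] fix_JI[OF y] y x JI_subset by auto
    then show "f x = x"
      using le_if_JI_le[OF x fx] le_if_JI_le[OF fx x] antisym[OF fx x] by blast
  qed
qed

lemma chi_D_le:
  assumes label: "\<And>s. s \<in> I \<Longrightarrow>
      S s \<subseteq> {1..card (C s)} \<and> g s \<in> S s \<rightarrow>\<^sub>E {..<M} \<and> inj_on (g s) (S s)"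
    and labels_differ: "\<And>s s'. \<lbrakk>s \<in> I; s' \<in> I; card (C s) = card (C s'); S s = S s'; g s = g s'\<rbrakk> \<Longrightarrow> s = s'"
  shows "chi_D A le \<le> M + card JI + 1"
proof -
  have "label_coloring S g ` A \<subseteq> {..<M + card JI + 1}"
  proof (rule image_subsetI)
    fix x assume "x \<in> A"
    show "label_coloring S g x \<in> {..<M + card JI + 1}"
    proof (cases "x \<in> JI \<and> rank x \<in> S (chain_of x)")
      case True
      then have "g (chain_of x) \<in> S (chain_of x) \<rightarrow>\<^sub>E {..<M}"
        using label chain_of_JI(1) by simp
      then have "g (chain_of x) (rank x) < M"
        using True by (auto simp: PiE_iff)
      then show ?thesis
        using True by (simp add: label_coloring_def)
    next
      case False
      then show ?thesis
        using rank_le[of x] by (simp add: label_coloring_def less_Suc_eq_le trans_le_add2)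
    qed
  qed
  moreover have "proper_coloring A le (label_coloring S g)"
    by (rule label_coloring_proper) (use label in blast)
  moreover have "distinguishing_coloring A le (label_coloring S g)"
    by (rule label_coloring_distinguishing) (use label labels_differ in \<open>auto simp: PiE_def\<close>)
  ultimately show ?thesis
    unfolding chi_D_def by (intro Least_le) blast
qed

end

section \<open>Counting partial injections\<close>

definition partial_injections :: "nat \<Rightarrow> nat \<Rightarrow> (nat set \<times> (nat \<Rightarrow> nat)) set" where
  "partial_injections r x = (SIGMA S:Pow {1..r}. {g \<in> S \<rightarrow>\<^sub>E {..<x}. inj_on g S})"

lemma finite_partial_injections: "finite (partial_injections r x)"
proof -
  have "finite {g \<in> S \<rightarrow>\<^sub>E {..<x}. inj_on g S}" if "S \<subseteq> {1..r}" for S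
    using that finite_PiE[of S "\<lambda>_. {..<x}"] finite_subset[OF that] by simp
  then show ?thesis
    unfolding partial_injections_def by (intro finite_SigmaI) auto
qed

text \<open>Group by the size \<open>l\<close> of the domain: there are \<open>r choose l\<close>
  domains, each with \<open>falling_factorial x l\<close> injections. Extensionality ensures that
  each partial injection is counted once.\<close>

lemma card_partial_injections:
  "card (partial_injections r x) = (\<Sum>l=0..min r x. (r choose l) * falling_factorial x l)"
proof -
  have card_inj: "finite {g \<in> S \<rightarrow>\<^sub>E {..<x}. inj_on g S} \<and>
      card {g \<in> S \<rightarrow>\<^sub>E {..<x}. inj_on g S} = falling_factorial x (card S)"
    if "S \<in> Pow {1..r}" for S
  proof -
    have "finite S" using that finite_subset by blast
    then show ?thesis
      using card_inj_on_subset_funcset[of S "{..<x}" S] finite_PiE[of S "\<lambda>_. {..<x}"]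
      by (simp add: falling_factorial_def lessThan_atLeast0)
  qed
  have "card (partial_injections r x) = (\<Sum>S\<in>Pow {1..r}. falling_factorial x (card S))"
    unfolding partial_injections_def using card_inj by (subst card_SigmaI) (auto intro!: sum.cong)
  also have "\<dots> = (\<Sum>l\<in>{0..r}. \<Sum>S | S \<in> Pow {1..r} \<and> card S = l. falling_factorial x (card S))"
  proof (rule sum.group[symmetric])
    show "card ` Pow {1..r} \<subseteq> {0..r}"
      using card_mono[of "{1..r}"] by fastforce
  qed auto
  also have "\<dots> = (\<Sum>l=0..r. (r choose l) * falling_factorial x l)"
    using n_subsets[of "{1..r}"] by (intro sum.cong) auto
  \<comment> \<open>The dropped terms have \<open>l > x\<close>, so their falling factorial contains
    the factor 0.\<close>
  also have "\<dots> = (\<Sum>l=0..min r x. (r choose l) * falling_factorial x l)"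
  proof (rule sum.mono_neutral_right)
    show "\<forall>l\<in>{0..r} - {0..min r x}. (r choose l) * falling_factorial x l = 0"
      by (auto simp: falling_factorial_def)
  qed auto
  finally show ?thesis .
qed

lemma partial_injections_mono: "x \<le> y \<Longrightarrow> partial_injections r x \<subseteq> partial_injections r y"
  by (fastforce simp: partial_injections_def PiE_iff)

lemma least_partial_injections:
  assumes "r \<ge> 1"
  shows "t \<le> card (partial_injections r (LEAST x. t \<le> card (partial_injections r x)))"
proof (rule LeastI)
  \<comment> \<open>The value \<open>t\<close> is a witness that the minimum exists: with
    \<open>r\<close> at least 1, the term for \<open>l = 1\<close> is \<open>r * t\<close>.\<close>
  show "t \<le> card (partial_injections r t)"
  proof (cases "t = 0")
    case False
    have "t \<le> (r choose 1) * falling_factorial t 1"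
      using assms by (simp add: falling_factorial_def)
    also have "\<dots> \<le> (\<Sum>l=0..min r t. (r choose l) * falling_factorial t l)"
      using False assms by (intro member_le_sum) auto
    finally show ?thesis
      by (simp add: card_partial_injections)
  qed simp
qed

text \<open>Flattens a sum of sums. It turns the blocks of equally long chains into one family of
  chains, indexed by block and number within the block.\<close>

lemma is_poset_sum_Sigma:
  assumes P: "is_poset_sum le I P A" and C: "\<And>i. i \<in> I \<Longrightarrow> is_poset_sum le (T i) (C i) (P i)"
  shows "is_poset_sum le (Sigma I T) (\<lambda>(i, s). C i s) A"
proof -
  have un: "P i = (\<Union>s\<in>T i. C i s)" if "i \<in> I" for i
    using C[OF that] by (simp add: is_poset_sum_def)
  have sub: "C i s \<subseteq> P i" if "i \<in> I" "s \<in> T i" for i s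
    using un that by blast
  have "A = (\<Union>(i, s)\<in>Sigma I T. C i s)"
    using P un by (auto simp: is_poset_sum_def)
  moreover have "C i s \<inter> C i' s' = {} \<and> (\<forall>x\<in>C i s. \<forall>y\<in>C i' s'. \<not> le x y)"
    if "i \<in> I" "s \<in> T i" "i' \<in> I" "s' \<in> T i'" "(i, s) \<noteq> (i', s')" for i s i' s'
  proof (cases "i = i'")
    case True
    then show ?thesis
      using C[OF that(1)] that unfolding is_poset_sum_def by blast
  next
    case False
    then have "P i \<inter> P i' = {} \<and> (\<forall>x\<in>P i. \<forall>y\<in>P i'. \<not> le x y)"
      using P that unfolding is_poset_sum_def by blast
    then show ?thesis
      using sub[OF that(1,2)] sub[OF that(3,4)] by blast
  qed
  ultimately show ?thesis
    unfolding is_poset_sum_def by auto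
qed

theorem theorem4p8:
  fixes n k j M :: nat
    and p a r t m :: "nat \<Rightarrow> nat"
    and Q :: "nat set"
    and Qs :: "nat \<Rightarrow> nat set"
  assumes primes: "\<And>i. i \<in> {1..k} \<Longrightarrow> prime (p i)"
    and distinct_primes: "inj_on p {1..k}"
    and exponents: "\<And>i. i \<in> {1..k} \<Longrightarrow> a i > 0"
    and n: "n = (\<Prod>i=1..k. p i ^ a i)"
    and Q: "Q = join_irreducibles (divisor_lattice n) (dvd)"
    and partition: "is_poset_sum (dvd) {1..j} Qs Q"
    and chains: "\<And>i. i \<in> {1..j} \<Longrightarrow> consists_of_chains (dvd) (Qs i) (t i) (r i)"
    and nonempty: "\<And>i. i \<in> {1..j} \<Longrightarrow> t i \<ge> 1 \<and> r i \<ge> 1"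
    and distinct_sizes: "inj_on r {1..j}"
    and m: "\<And>i. i \<in> {1..j} \<Longrightarrow>
      m i = (LEAST x. t i \<le> (\<Sum>l=0..min (r i) x. (r i choose l) * falling_factorial x l))"
    and M: "M = Max (insert 0 (m ` {1..j}))"
  shows "chi_D (divisor_lattice n) (dvd) \<le> M + card Q + 1"
proof -
  \<comment> \<open>Positivity makes the lattice finite, since every number divides 0.\<close>
  have n0: "n > 0"
    using primes by (auto simp: n prime_gt_0_nat)
  have "\<exists>C. is_poset_sum (dvd) {1..t i} C (Qs i) \<and>
      (\<forall>s\<in>{1..t i}. is_chain (dvd) (C s) \<and> finite (C s) \<and> card (C s) = r i)" if "i \<in> {1..j}" for i
    using chains[OF that] by (simp add: consists_of_chains_def)
  then obtain C where C: "\<And>i. i \<in> {1..j} \<Longrightarrow> is_poset_sum (dvd) {1..t i} (C i) (Qs i)"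
      "\<And>i s. i \<in> {1..j} \<Longrightarrow> s \<in> {1..t i} \<Longrightarrow> is_chain (dvd) (C i s) \<and> card (C i s) = r i"
    by metis
  \<comment> \<open>Block \<open>i\<close> has enough labels with \<open>m i\<close> extra colors,
    hence also with \<open>M\<close>, so its chains can be labeled injectively.\<close>
  have "\<exists>e. e ` {1..t i} \<subseteq> partial_injections (r i) M \<and> inj_on e {1..t i}" if i: "i \<in> {1..j}" for i
  proof (rule card_le_inj)
    have "t i \<le> card (partial_injections (r i) (m i))"
      using least_partial_injections[of "r i" "t i"] nonempty[OF i] m[OF i]
      by (simp add: card_partial_injections)
    also have "m i \<le> M"
      using i by (simp add: M)
    then have "card (partial_injections (r i) (m i)) \<le> card (partial_injections (r i) M)"
      by (intro card_mono finite_partial_injections partial_injections_mono)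
    finally show "card {1..t i} \<le> card (partial_injections (r i) M)"
      by simp
  qed (auto simp: finite_partial_injections)
  then obtain e where e: "\<And>i. i \<in> {1..j} \<Longrightarrow> e i ` {1..t i} \<subseteq> partial_injections (r i) M"
      "\<And>i. i \<in> {1..j} \<Longrightarrow> inj_on (e i) {1..t i}"
    by metis
  interpret JI_sum_of_chains "divisor_lattice n" "(dvd)"
    "SIGMA i:{1..j}. {1..t i}" "\<lambda>(i, s). C i s"
  proof
    show "finite (divisor_lattice n)"
      using n0 by (simp add: divisor_lattice_def)
    show "is_poset_sum (dvd) (SIGMA i:{1..j}. {1..t i}) (\<lambda>(i, s). C i s)
        (join_irreducibles (divisor_lattice n) (dvd))"
      using is_poset_sum_Sigma[OF partition C(1)] Q by simp
    show "is_chain (dvd) (case is of (i, s) \<Rightarrow> C i s)" if "is \<in> (SIGMA i:{1..j}. {1..t i})" for "is"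
      using that C(2) by auto
  qed (auto intro: dvd_trans dvd_antisym)
  show ?thesis
    unfolding Q
  proof (rule chi_D_le[where S = "\<lambda>(i, s). fst (e i s)" and g = "\<lambda>(i, s). snd (e i s)"], goal_cases)
    case (1 u)
    then obtain i s where u: "u = (i, s)" "i \<in> {1..j}" "s \<in> {1..t i}"
      by auto
    then have "e i s \<in> partial_injections (r i) M"
      using e(1) by blast
    then show ?case
      using C(2)[OF u(2,3)] by (auto simp: u(1) partial_injections_def)
  next
    case (2 u u')
    then obtain i s i' s' where u: "u = (i, s)" "i \<in> {1..j}" "s \<in> {1..t i}"
        "u' = (i', s')" "i' \<in> {1..j}" "s' \<in> {1..t i'}"
      by auto
    \<comment> \<open>Chains of equal size lie in the same block because block sizes are distinct;
      within a block, \<open>e i\<close> separates the chains.\<close>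
    have "r i = r i'"
      using 2(3) C(2)[OF u(2,3)] C(2)[OF u(5,6)] u(1,4) by simp
    then have "i = i'"
      using distinct_sizes u by (auto dest: inj_onD)
    moreover have "e i s = e i' s'"
      using 2(4,5) u(1,4) by (simp add: prod_eq_iff)
    ultimately show ?case
      using e(2)[OF u(2)] u by (auto dest: inj_onD)
  qed
qed

end
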